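(* For an open extension $q\colon(K,G,\varphi)\to(L,G,\psi)$ of topological dynamical systems the following assertions are equivalent. (a) $q$ is equicontinuous. (b) $\{\varphi_g|_{K_l}: g\in G,\ l\in L\}\subset\mathrm C_q^q(K,K)$ is precompact. (c) $\{(T_{\varphi_g}f)|_{K_l}: g\in G,\ l\in L\}\subset\mathrm C_q(K)$ is equicontinuous for every $f\in\mathrm C(K)$. (d) $\{(T_{\varphi_g}f)|_{K_l}: g\in G,\ l\in L\}\subset\mathrm C_q(K)$ is precompact for every $f\in\mathrm C(K)$.
   Context: All compact spaces are Hausdorff and carry their unique compatible uniformity. A topological dynamical system $(K,G,\varphi)$ consists of a nonempty compact space $K$, a Hausdorff topological group $G$ and a continuous action $\varphi\colon G\times K\to K$; $\varphi_g=\varphi(g,\cdot)$. An extension $q\colon(K,G,\varphi)\to(L,G,\psi)$ is a continuous surjection $q\colon K\to L$ with $q\circ\varphi_g=\psi_g\circ q$ for all $g$; it is open if $q$ is open. $K_l=q^{-1}(l)$, and $T_{\varphi_g}f=f\circ\varphi_g$ for $f\in\mathrm C(K)$. $q$ is equicontinuous if for each entourage $U$ of $K$ there is an entourage $V$ of $K$ such that $(\varphi_gx,\varphi_gy)\in U$ for all $g\in G$ and all $x,y\in K$ with $q(x)=q(y)$ and $(x,y)\in V$. $\mathrm C_q^q(K,K)=\bigcup_{l,l'\in L}\mathrm C(K_l,K_{l'})$ and $\mathrm C_q(K)=\bigcup_{l\in L}\mathrm C(K_l,\mathbb C)$; $s(\theta)=l$ if $\theta$ has domain $K_l$. With $Y=K$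 resp. $Y=\mathbb C$, both carry the compact-open topology generated by the sets $W(C,O)=\{\theta:\theta(C\cap K_{s(\theta)})\subset O\}$, $C\subset K$ compact, $O\subset Y$ open. Precompact means having compact closure. A subset $\mathcal F$ of one of these spaces is equicontinuous if for each entourage $U$ of $Y$ there is an entourage $V$ of $K$ such that $(\theta(x_1),\theta(x_2))\in U$ for every $\theta\in\mathcal F$ and all $x_1,x_2\in K_{s(\theta)}$ with $(x_1,x_2)\in V$. *)

theory Defs
  imports "HOL-Analysis.Analysis"
begin

text \<open>
  Compact spaces are Hausdorff types whose universe is compact, hence automatically nonempty;
  the class \<open>uniform_space\<close> provides a uniformity compatible with the topology (on a compact
  Hausdorff space there is only one), and an entourage is a set belonging to that filter.
  The acting group is an arbitrary, not necessarily commutative, Hausdorff topological group;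
  the class \<open>topological_group_add\<close> merely writes its operation additively.
\<close>

definition entourage :: "('a::uniform_space \<times> 'a) set \<Rightarrow> bool" where
  "entourage U \<longleftrightarrow> (\<forall>\<^sub>F p in uniformity. p \<in> U)"

definition tds :: "('g::{topological_group_add,t2_space} \<Rightarrow> 'k::t2_space \<Rightarrow> 'k) \<Rightarrow> bool" where
  "tds \<phi> \<longleftrightarrow>
     compact (UNIV :: 'k set) \<and>
     continuous_on UNIV (\<lambda>(g, x). \<phi> g x) \<and>
     (\<forall>x. \<phi> 0 x = x) \<and>
     (\<forall>g h x. \<phi> (g + h) x = \<phi> g (\<phi> h x))"

definition tds_extension ::
  "('g::{topological_group_add,t2_space} \<Rightarrow> 'k::t2_space \<Rightarrow> 'k) \<Rightarrow>
   ('g \<Rightarrow> 'l::t2_space \<Rightarrow> 'l) \<Rightarrow> ('k \<Rightarrow> 'l) \<Rightarrow> bool" where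
  "tds_extension \<phi> \<psi> q \<longleftrightarrow>
     tds \<phi> \<and> tds \<psi> \<and> continuous_on UNIV q \<and> surj q \<and> (\<forall>g. q \<circ> \<phi> g = \<psi> g \<circ> q)"

definition open_tds_extension ::
  "('g::{topological_group_add,t2_space} \<Rightarrow> 'k::t2_space \<Rightarrow> 'k) \<Rightarrow>
   ('g \<Rightarrow> 'l::t2_space \<Rightarrow> 'l) \<Rightarrow> ('k \<Rightarrow> 'l) \<Rightarrow> bool" where
  "open_tds_extension \<phi> \<psi> q \<longleftrightarrow> tds_extension \<phi> \<psi> q \<and> open_map euclidean euclidean q"

definition fiber :: "('k \<Rightarrow> 'l) \<Rightarrow> 'l \<Rightarrow> 'k set" where
  "fiber q l = q -` {l}"

definition equicontinuous_extension ::
  "('g \<Rightarrow> 'k::uniform_space \<Rightarrow> 'k) \<Rightarrow> ('k \<Rightarrow> 'l) \<Rightarrow> bool" where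
  "equicontinuous_extension \<phi> q \<longleftrightarrow>
     (\<forall>U. entourage U \<longrightarrow>
        (\<exists>V. entourage V \<and>
           (\<forall>g x y. q x = q y \<and> (x, y) \<in> V \<longrightarrow> (\<phi> g x, \<phi> g y) \<in> U)))"

text \<open>
  A continuous function defined on a fiber only is a partial map whose domain is that fiber.
\<close>

definition cmaps :: "'k::topological_space set \<Rightarrow> 'y::topological_space set \<Rightarrow> ('k \<rightharpoonup> 'y) set" where
  "cmaps A B = {\<theta>. dom \<theta> = A \<and> ran \<theta> \<subseteq> B \<and> continuous_on A (\<lambda>x. the (\<theta> x))}"

definition C_qq :: "('k::topological_space \<Rightarrow> 'l) \<Rightarrow> ('k \<rightharpoonup> 'k) set" where
  "C_qq q = (\<Union>l. \<Union>l'. cmaps (fiber q l) (fiber q l'))"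

definition C_q :: "('k::topological_space \<Rightarrow> 'l) \<Rightarrow> ('k \<rightharpoonup> complex) set" where
  "C_q q = (\<Union>l. cmaps (fiber q l) UNIV)"

text \<open>Well defined when \<open>q\<close> is surjective, since distinct fibers are then distinct sets.\<close>

definition source :: "('k \<Rightarrow> 'l) \<Rightarrow> ('k \<rightharpoonup> 'y) \<Rightarrow> 'l" where
  "source q \<theta> = (THE l. dom \<theta> = fiber q l)"

definition restr :: "('k \<Rightarrow> 'y) \<Rightarrow> 'k set \<Rightarrow> ('k \<rightharpoonup> 'y)" where
  "restr f A = (Some \<circ> f) |` A"

text \<open>
  The compact-open topology on a set \<open>E\<close> of maps defined on fibers; as \<open>W E {} {} = E\<close>,
  the topology generated by the sets \<open>W E C O\<close> lives on all of \<open>E\<close>.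
\<close>

definition W ::
  "('k \<Rightarrow> 'l) \<Rightarrow> ('k \<rightharpoonup> 'y) set \<Rightarrow> 'k set \<Rightarrow> 'y set \<Rightarrow> ('k \<rightharpoonup> 'y) set" where
  "W q E C O' = {\<theta> \<in> E. (\<lambda>x. the (\<theta> x)) ` (C \<inter> fiber q (source q \<theta>)) \<subseteq> O'}"

definition compact_open ::
  "('k::topological_space \<Rightarrow> 'l) \<Rightarrow> ('k \<rightharpoonup> 'y::topological_space) set \<Rightarrow> ('k \<rightharpoonup> 'y) topology" where
  "compact_open q E = topology_generated_by {W q E C O' | C O'. compact C \<and> open O'}"

definition precompactin :: "'a topology \<Rightarrow> 'a set \<Rightarrow> bool" where
  "precompactin T S \<longleftrightarrow> S \<subseteq> topspace T \<and> compactin T (T closure_of S)"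

definition equicontinuous_family ::
  "('k::uniform_space \<Rightarrow> 'l) \<Rightarrow> ('k \<rightharpoonup> 'y::uniform_space) set \<Rightarrow> bool" where
  "equicontinuous_family q F \<longleftrightarrow>
     (\<forall>U. entourage U \<longrightarrow>
        (\<exists>V. entourage V \<and>
           (\<forall>\<theta>\<in>F. \<forall>x1\<in>fiber q (source q \<theta>). \<forall>x2\<in>fiber q (source q \<theta>).
              (x1, x2) \<in> V \<longrightarrow> (the (\<theta> x1), the (\<theta> x2)) \<in> U)))"

definition koopman :: "('g \<Rightarrow> 'k \<Rightarrow> 'k) \<Rightarrow> 'g \<Rightarrow> ('k \<Rightarrow> complex) \<Rightarrow> 'k \<Rightarrow> complex" where
  "koopman \<phi> g f = f \<circ> \<phi> g"

lemma topspace_compact_open: "topspace (compact_open q E) = E"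
proof -
  have "W q E {} {} = E"
    by (auto simp: W_def)
  then have "E \<in> {W q E C O' | C O'. compact C \<and> open O'}"
    by (metis (mono_tags, lifting) compact_empty mem_Collect_eq open_empty)
  then show ?thesis
    by (auto simp: compact_open_def W_def)
qed

lemma dom_restr [simp]: "dom (restr f A) = A"
  by (auto simp: restr_def dom_def restrict_map_def)

lemma source_eq:
  assumes "surj q" "dom \<theta> = fiber q l"
  shows "source q \<theta> = l"
  unfolding source_def
proof (rule the_equality)
  fix l' assume "dom \<theta> = fiber q l'"
  then have "fiber q l = fiber q l'" using assms by simp
  moreover obtain x where "q x = l" using assms(1) by (metis surjD)
  ultimately show "l' = l" by (auto simp: fiber_def)
qed (use assms in simp)

lemma restr_in_C_qq:
  assumes "tds_extension \<phi> \<psi> q"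
  shows "restr (\<phi> g) (fiber q l) \<in> C_qq q"
proof -
  have c: "continuous_on UNIV (\<lambda>(g, x). \<phi> g x)" and e: "q \<circ> \<phi> g = \<psi> g \<circ> q"
    using assms by (auto simp: tds_extension_def tds_def)
  have "continuous_on UNIV ((\<lambda>(g, x). \<phi> g x) \<circ> (\<lambda>x. (g, x)))"
    by (intro continuous_on_compose continuous_intros continuous_on_subset[OF c]) auto
  then have "continuous_on (fiber q l) (\<phi> g)"
    by (auto simp: comp_def intro: continuous_on_subset)
  then have "continuous_on (fiber q l) (\<lambda>x. the (restr (\<phi> g) (fiber q l) x))"
    by (subst continuous_on_cong[OF refl, where g = "\<phi> g"]) (auto simp: restr_def)
  moreover have "ran (restr (\<phi> g) (fiber q l)) \<subseteq> fiber q (\<psi> g l)"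
    using e by (auto simp: restr_def ran_def restrict_map_def fiber_def fun_eq_iff split: if_splits)
  ultimately show ?thesis
    unfolding C_qq_def cmaps_def by auto
qed

end

theory Submission
  imports Defs
begin

text \<open>
  The heart of the matter is an Arzela-Ascoli theorem for maps defined on the fibers of \<open>q\<close>: a
  family whose values lie in a compact set is precompact in the compact-open topology if and only
  if it is equicontinuous. Given this, (b) and (d) become equicontinuity statements. Equicontinuity
  of the maps \<open>\<phi> g\<close> on fibers is a rewording of (a), and so (a) and (b) are equivalent, as
  are (c) and (d). Next, (a) implies (c) because a continuous function on a compact space is
  uniformly continuous. Conversely (c) implies (a) because, by Urysohn's lemma, membership in an
  entourage follows once the values of finitely many continuous functions are close
  (\<open>entourage_finitely_many_functions\<close>).

  Precompact families are equicontinuous (\<open>precompact_imp_equicontinuous\<close>): near a given map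
  \<open>\<theta>\<close> on a fiber, finitely many conditions \<open>W q E C O'\<close>, together with the condition that the
  fiber stays close to that of \<open>\<theta>\<close>, force a common modulus of continuity, and finitely many
  such neighborhoods cover the compact closure of the family.

  For the converse (\<open>equicontinuous_imp_precompact\<close>) the varying domains rule out the usual
  argument by pointwise limits in a product space. Graphs of maps replace it: they are closed
  subsets of the compact space \<open>UNIV \<times> B\<close>, and the closed subsets of a compact space form a
  compact space in the hit-and-miss topology, by Alexander's subbase theorem. Let \<open>Q\<close> be the
  closure of the set of all pairs of points on a common graph of the family. Being the graph of a
  map on a full fiber that is as equicontinuous as the family amounts to two conditions on a closed
  set \<open>A\<close>. The first is \<open>A \<times> A \<subseteq> Q\<close>, which is closed since \<open>Q\<close> is. The second is that
  \<open>A\<close> is nonempty and its projection is a union of fibers; this is closed since \<open>q\<close> is open. So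
  these graphs form a compact set. The compact-open topology is a miss topology in terms of graphs,
  hence the passage from graphs to maps is continuous and the corresponding set \<open>M\<close> of maps is
  compact. Finally \<open>M\<close> is closed in the compact-open topology, again by openness of \<open>q\<close>:
  meeting an open set is an open condition on the graph (\<open>openin_compact_open_hit\<close>). Thus
  \<open>M\<close> contains the closure of the family.
\<close>


section \<open>Entourages and compact sets\<close>

lemma entourage_refl: "entourage U \<Longrightarrow> (x, x) \<in> U"
  by (auto simp: entourage_def dest: uniformity_refl)

lemma entourage_nhd:
  assumes "entourage U"
  obtains N where "open N" "x \<in> N" "\<And>y. y \<in> N \<Longrightarrow> (x, y) \<in> U"
proof -
  have "\<forall>\<^sub>F y in nhds x. (x, y) \<in> U"
    using assms unfolding entourage_def eventually_nhds_uniformity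
    by (rule eventually_mono) auto
  then show ?thesis
    using that unfolding eventually_nhds by blast
qed

lemma open_entourage:
  assumes "open N" "x \<in> N"
  obtains U where "entourage U" "\<And>y. (x, y) \<in> U \<Longrightarrow> y \<in> N"
proof
  show "entourage {(x', y). x' = x \<longrightarrow> y \<in> N}"
    using assms unfolding open_uniformity entourage_def
    by (simp add: case_prod_unfold)
qed (use assms in auto)

lemma entourage_Int: "entourage U \<Longrightarrow> entourage V \<Longrightarrow> entourage (U \<inter> V)"
  by (auto simp: entourage_def eventually_conj_iff)

lemma entourage_INT:
  assumes "finite T" "\<And>x. x \<in> T \<Longrightarrow> entourage (V x)"
  shows "entourage {p. \<forall>x\<in>T. p \<in> V x}"
  using assms by (simp add: entourage_def eventually_ball_finite_distrib)

lemma entourage_converse: "entourage U \<Longrightarrow> entourage (U\<inverse>)"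
  unfolding entourage_def by (drule uniformity_sym) (simp add: case_prod_unfold converse_unfold)

lemma entourage_comp:
  assumes "entourage U"
  obtains D where "entourage D" "D O D \<subseteq> U"
proof -
  obtain P where "eventually P uniformity" "\<And>x y z. P (x, y) \<Longrightarrow> P (y, z) \<Longrightarrow> (x, z) \<in> U"
    using uniformity_transE[OF assms[unfolded entourage_def]] by metis
  then show ?thesis
    by (intro that[of "Collect P"]) (auto simp: entourage_def)
qed

lemma entourage_sym_cube:
  assumes "entourage U"
  obtains D where "entourage D" "sym D" "D O D O D \<subseteq> U"
proof -
  obtain D1 where D1: "entourage D1" "D1 O D1 \<subseteq> U" using entourage_comp[OF assms] .
  obtain D2 where D2: "entourage D2" "D2 O D2 \<subseteq> D1" using entourage_comp[OF D1(1)] .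
  define D where "D = (D1 \<inter> D2) \<inter> (D1 \<inter> D2)\<inverse>"
  have "D O D O D \<subseteq> D1 O (D2 O D2)" unfolding D_def by blast
  also have "\<dots> \<subseteq> U" using D1 D2 by blast
  finally show ?thesis
    using D1 D2 by (intro that[of D])
      (auto simp: D_def sym_def intro!: entourage_Int entourage_converse)
qed

lemma entourage_square_nhd:
  assumes "entourage U"
  obtains N where "open N" "x \<in> N" "N \<times> N \<subseteq> U"
proof -
  obtain D where D: "entourage D" "sym D" "D O D O D \<subseteq> U" using entourage_sym_cube[OF assms] .
  obtain N where N: "open N" "x \<in> N" "\<And>y. y \<in> N \<Longrightarrow> (x, y) \<in> D"
    using entourage_nhd[OF D(1)] by metis
  have "(a, b) \<in> U" if "a \<in> N" "b \<in> N" for a b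
  proof -
    have "(a, x) \<in> D" "(x, b) \<in> D" "(b, b) \<in> D"
      using N(3) that D entourage_refl by (auto dest: symD)
    then show ?thesis using D(3) by blast
  qed
  then show ?thesis using N by (intro that[of N]) auto
qed

lemma entourages_separate:
  fixes y z :: "'y::{uniform_space,t2_space}"
  assumes "\<And>U. entourage U \<Longrightarrow> (y, z) \<in> U"
  shows "y = z"
proof (rule ccontr)
  assume "y \<noteq> z"
  then obtain N where "open N" "y \<in> N" "z \<notin> N"
    using separation_t1 by metis
  then show False using open_entourage[of N y] assms by metis
qed

text \<open>
  A uniform version of the Lebesgue number lemma. The points need not lie in the compact set:
  the open set \<open>G\<close> allows for the fibers near a given one.
\<close>

lemma lebesgue_entourage:
  fixes S :: "'k::uniform_space set"
  assumes "compact S" and N: "\<And>x. x \<in> S \<Longrightarrow> open (N x)" "\<And>x. x \<in> S \<Longrightarrow> x \<in> N x"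
  obtains T G V where "finite T" "T \<subseteq> S" "open G" "S \<subseteq> G" "entourage V"
    "\<And>a b. a \<in> G \<Longrightarrow> (a, b) \<in> V \<Longrightarrow> \<exists>x\<in>T. a \<in> N x \<and> b \<in> N x"
proof -
  have "\<exists>D M. entourage D \<and> (\<forall>a b. (x, a) \<in> D \<longrightarrow> (a, b) \<in> D \<longrightarrow> b \<in> N x) \<and>
          open M \<and> x \<in> M \<and> (\<forall>a\<in>M. (x, a) \<in> D)" if "x \<in> S" for x
  proof -
    obtain U where U: "entourage U" "\<And>y. (x, y) \<in> U \<Longrightarrow> y \<in> N x"
      using open_entourage N \<open>x \<in> S\<close> by metis
    obtain D where D: "entourage D" "D O D \<subseteq> U" using entourage_comp[OF U(1)] .
    obtain M where "open M" "x \<in> M" "\<And>a. a \<in> M \<Longrightarrow> (x, a) \<in> D"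
      using entourage_nhd[OF D(1)] by metis
    then show ?thesis using D U by (intro exI[of _ D] exI[of _ M]) blast
  qed
  then have "\<forall>x\<in>S. \<exists>D M. entourage D \<and> (\<forall>a b. (x, a) \<in> D \<longrightarrow> (a, b) \<in> D \<longrightarrow> b \<in> N x) \<and>
          open M \<and> x \<in> M \<and> (\<forall>a\<in>M. (x, a) \<in> D)" by blast
  from bchoice[OF this] obtain D where "\<forall>x\<in>S. \<exists>M. entourage (D x) \<and>
          (\<forall>a b. (x, a) \<in> D x \<longrightarrow> (a, b) \<in> D x \<longrightarrow> b \<in> N x) \<and>
          open M \<and> x \<in> M \<and> (\<forall>a\<in>M. (x, a) \<in> D x)" ..
  from bchoice[OF this] obtain M where "\<forall>x\<in>S. entourage (D x) \<and>
          (\<forall>a b. (x, a) \<in> D x \<longrightarrow> (a, b) \<in> D x \<longrightarrow> b \<in> N x) \<and>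
          open (M x) \<and> x \<in> M x \<and> (\<forall>a\<in>M x. (x, a) \<in> D x)" ..
  then have DM: "\<And>x. x \<in> S \<Longrightarrow> entourage (D x)"
    "\<And>x a b. x \<in> S \<Longrightarrow> (x, a) \<in> D x \<Longrightarrow> (a, b) \<in> D x \<Longrightarrow> b \<in> N x"
    "\<And>x. x \<in> S \<Longrightarrow> open (M x)" "\<And>x. x \<in> S \<Longrightarrow> x \<in> M x"
    "\<And>x a. x \<in> S \<Longrightarrow> a \<in> M x \<Longrightarrow> (x, a) \<in> D x"
    by blast+
  obtain T where T: "T \<subseteq> S" "finite T" "S \<subseteq> (\<Union>x\<in>T. M x)"
    by (rule compactE_image[OF assms(1), of S M]) (use DM in auto)
  show ?thesis
  proof
    show "entourage {p. \<forall>x\<in>T. p \<in> D x}"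
      using T DM by (intro entourage_INT) auto
    show "open (\<Union>x\<in>T. M x)" using T(1) DM(3) by (intro open_UN) blast
    fix a b
    assume "a \<in> (\<Union>x\<in>T. M x)" and ab: "(a, b) \<in> {p. \<forall>x\<in>T. p \<in> D x}"
    then obtain x where x: "x \<in> T" "a \<in> M x" by auto
    then have "(x, a) \<in> D x" "(a, b) \<in> D x" "(a, a) \<in> D x"
      using DM(5) T(1) ab entourage_refl[OF DM(1)] by (auto simp: subset_iff)
    then show "\<exists>x\<in>T. a \<in> N x \<and> b \<in> N x" using x DM(2) T by (meson subsetD)
  qed (use T in auto)
qed

lemma compact_imp_uniformly_continuous:
  fixes f :: "'k::uniform_space \<Rightarrow> 'y::uniform_space"
  assumes "compact (UNIV :: 'k set)" "continuous_on UNIV f" "entourage U"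
  obtains V where "entourage V" "\<And>x y. (x, y) \<in> V \<Longrightarrow> (f x, f y) \<in> U"
proof -
  have "\<exists>M. open M \<and> f x \<in> M \<and> M \<times> M \<subseteq> U" for x
    using entourage_square_nhd[OF assms(3)] by metis
  then obtain M where M: "\<And>x. open (M x)" "\<And>x. f x \<in> M x" "\<And>x. M x \<times> M x \<subseteq> U"
    by metis
  have "open (f -` M x)" for x using M(1) assms(2) by (simp add: open_vimage)
  then obtain T G V where V: "UNIV \<subseteq> G" "entourage V"
    "\<And>a b. a \<in> G \<Longrightarrow> (a, b) \<in> V \<Longrightarrow> \<exists>x\<in>T. a \<in> f -` M x \<and> b \<in> f -` M x"
    by (rule lebesgue_entourage[OF assms(1), of "\<lambda>x. f -` M x"]) (use M(2) in auto)
  show ?thesis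
  proof (rule that[OF V(2)])
    fix x y assume "(x, y) \<in> V"
    then obtain t where "f x \<in> M t" "f y \<in> M t" using V(1,3) by blast
    then show "(f x, f y) \<in> U" using M(3) by blast
  qed
qed

lemma compact_t2_nested_nhd:
  fixes x :: "'k::t2_space"
  assumes "compact (UNIV :: 'k set)" "open N" "x \<in> N"
  obtains M C where "open M" "closed C" "x \<in> M" "M \<subseteq> C" "C \<subseteq> N"
proof -
  have "regular_space (euclidean :: 'k topology)"
    using assms(1) by (intro compact_Hausdorff_imp_regular_space)
      (auto simp: compact_space_def Hausdorff_space_def disjnt_def separation_t2)
  then obtain M P where "open M" "open P" "x \<in> M" "- N \<subseteq> P" "disjnt M P"
    unfolding regular_space_def using assms(2,3)
    by (auto dest!: spec[of _ "- N"])
  then show ?thesis by (intro that[of M "- P"]) (auto simp: disjnt_def)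
qed

text \<open>
  On a compact Hausdorff space the uniformity is generated by the continuous functions, so an
  entourage can be tested on finitely many of them. The functions come from Urysohn's lemma:
  \<open>f x\<close> is \<open>0\<close> at \<open>x\<close> and \<open>1\<close> off a small neighborhood of \<open>x\<close>.
\<close>

lemma entourage_finitely_many_functions:
  fixes U :: "('k::{uniform_space,t2_space} \<times> 'k) set"
  assumes "compact (UNIV :: 'k set)" "entourage U"
  obtains T :: "('k \<Rightarrow> complex) set" where "finite T" "\<And>f. f \<in> T \<Longrightarrow> continuous_on UNIV f"
    "\<And>x y. (\<And>f. f \<in> T \<Longrightarrow> dist (f x) (f y) < 1/2) \<Longrightarrow> (x, y) \<in> U"
proof -
  have norm: "normal_space (euclidean :: 'k topology)"
    using assms(1) by (intro compact_Hausdorff_or_regular_imp_normal_space)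
      (auto simp: compact_space_def Hausdorff_space_def disjnt_def separation_t2)
  have "\<exists>f :: 'k \<Rightarrow> complex. continuous_on UNIV f \<and> f x = 0 \<and>
          (\<forall>a b. norm (f a) < 1 \<longrightarrow> norm (f b) < 1 \<longrightarrow> (a, b) \<in> U)" for x
  proof -
    obtain N where N: "open N" "x \<in> N" "N \<times> N \<subseteq> U" using entourage_square_nhd[OF assms(2)] .
    obtain h where h: "continuous_map euclidean euclideanreal h" "h ` {x} \<subseteq> {0}" "h ` (- N) \<subseteq> {1}"
      using norm[unfolded normal_space_iff_Urysohn_alt, rule_format, of "{x}" "- N"] N
      by (auto simp: disjnt_def)
    have "continuous_on UNIV (\<lambda>a. complex_of_real (h a))"
      using h(1) by (intro continuous_intros) auto
    moreover have "(a, b) \<in> U"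
      if "norm (complex_of_real (h a)) < 1" "norm (complex_of_real (h b)) < 1" for a b
    proof -
      have "c \<in> N" if "norm (complex_of_real (h c)) < 1" for c
        using that h(3) by (cases "c \<in> N") auto
      then show ?thesis using that N(3) by blast
    qed
    ultimately show ?thesis using h(2) by (intro exI[of _ "\<lambda>a. complex_of_real (h a)"]) auto
  qed
  then obtain f :: "'k \<Rightarrow> 'k \<Rightarrow> complex" where f: "\<And>x. continuous_on UNIV (f x)" "\<And>x. f x x = 0"
    "\<And>x a b. norm (f x a) < 1 \<Longrightarrow> norm (f x b) < 1 \<Longrightarrow> (a, b) \<in> U"
    by metis
  have op: "open (f x -` ball 0 (1/2))" for x using f(1) by (simp add: open_vimage)
  have "UNIV \<subseteq> (\<Union>x. f x -` ball 0 (1/2))"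
  proof
    fix x show "x \<in> (\<Union>x. f x -` ball 0 (1/2))" by (intro UN_I[of x]) (auto simp: f(2))
  qed
  then obtain T where T: "finite T" "UNIV \<subseteq> (\<Union>x\<in>T. f x -` ball 0 (1/2))"
    by (rule compactE_image[OF assms(1) op])
  show ?thesis
  proof
    show "finite (f ` T)" using T by simp
    show "continuous_on UNIV h" if "h \<in> f ` T" for h using that f by auto
    fix a b
    assume *: "\<And>h. h \<in> f ` T \<Longrightarrow> dist (h a) (h b) < 1/2"
    obtain x where x: "x \<in> T" "norm (f x a) < 1/2"
      using T(2) by (auto simp: subset_iff)
    have "norm (f x b) < 1"
      using x *[of "f x"] norm_triangle_ineq2[of "f x b" "f x a"]
      by (simp add: dist_norm norm_minus_commute)
    then show "(a, b) \<in> U" using x f(3)[of x a b] by simp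
  qed
qed


section \<open>The hit-and-miss topology on closed sets\<close>

definition hit :: "'z::topological_space set \<Rightarrow> 'z set \<Rightarrow> 'z set set" where
  "hit Z P = {A. closed A \<and> A \<subseteq> Z \<and> A \<inter> P \<noteq> {}}"

definition miss :: "'z::topological_space set \<Rightarrow> 'z set \<Rightarrow> 'z set set" where
  "miss Z D = {A. closed A \<and> A \<subseteq> Z \<and> A \<inter> D = {}}"

text \<open>The Fell topology on the closed subsets of \<open>Z\<close>.\<close>

definition fell :: "'z::topological_space set \<Rightarrow> 'z set topology" where
  "fell Z = topology_generated_by ({hit Z P | P. open P} \<union> {miss Z D | D. closed D})"

lemma topspace_fell: "topspace (fell Z) = {A. closed A \<and> A \<subseteq> Z}"
proof -
  have "miss Z {} = {A. closed A \<and> A \<subseteq> Z}" by (simp add: miss_def)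
  then have "{A. closed A \<and> A \<subseteq> Z} \<in> {miss Z D | D. closed D}"
    by (metis (mono_tags, lifting) closed_empty mem_Collect_eq)
  then have "{A. closed A \<and> A \<subseteq> Z} \<subseteq> topspace (fell Z)" by (auto simp: fell_def)
  moreover have "topspace (fell Z) \<subseteq> {A. closed A \<and> A \<subseteq> Z}"
    by (auto simp: fell_def hit_def miss_def)
  ultimately show ?thesis by blast
qed

lemma openin_hit: "open P \<Longrightarrow> openin (fell Z) (hit Z P)"
  unfolding fell_def by (rule topology_generated_by_Basis) auto

lemma openin_miss: "closed D \<Longrightarrow> openin (fell Z) (miss Z D)"
  unfolding fell_def by (rule topology_generated_by_Basis) auto

text \<open>Alexander's subbase theorem.\<close>

lemma compact_space_topology_generated_by:
  assumes "\<And>\<C>. \<C> \<subseteq> \<B> \<Longrightarrow> \<Union>\<C> = \<Union>\<B> \<Longrightarrow> \<exists>\<C>'. finite \<C>' \<and> \<C>' \<subseteq> \<C> \<and> \<Union>\<C>' = \<Union>\<B>"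
  shows "compact_space (topology_generated_by \<B>)"
proof -
  define X where "X = topology (arbitrary union_of (finite intersection_of (\<lambda>x. x \<in> \<B>) relative_to \<Union>\<B>))"
  have top: "topspace X = \<Union>\<B>" unfolding X_def by (rule topspace_subbase)
  have cpt: "compact_space X"
    by (rule Alexander_subbase[OF X_def[symmetric]]) (use assms top in auto)
  have "continuous_map X (topology_generated_by \<B>) (\<lambda>x. x)"
  proof (rule continuous_on_generated_topo)
    fix U assume "U \<in> \<B>"
    then have "(finite intersection_of (\<lambda>x. x \<in> \<B>) relative_to \<Union>\<B>) (\<Union>\<B> \<inter> U)"
      by (intro relative_to_inc finite_intersection_of_inc)
    then have "openin X (\<Union>\<B> \<inter> U)"
      unfolding X_def openin_subbase by (rule arbitrary_union_of_inc)
    then show "openin X ((\<lambda>x. x) -` U \<inter> topspace X)"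
      by (simp add: top Int_commute)
  qed (simp add: top)
  from image_compactin[OF cpt[unfolded compact_space_def] this] show ?thesis
    by (simp add: compact_space_def top)
qed

text \<open>
  Given a subbasic cover, remove from \<open>Z\<close> all the open sets whose hit sets are used. The remaining
  closed set can only be covered by some \<open>miss Z D\<close>; then \<open>Z \<inter> D\<close> is covered by these open
  sets, and finitely many of them suffice.
\<close>

lemma compact_space_fell:
  fixes Z :: "'z::t2_space set"
  assumes "compact Z"
  shows "compact_space (fell Z)"
  unfolding fell_def
proof (rule compact_space_topology_generated_by)
  let ?B = "{hit Z P | P. open P} \<union> {miss Z D | D. closed D}"
  fix \<C> assume \<C>: "\<C> \<subseteq> ?B" and "\<Union>\<C> = \<Union>?B"
  then have cover: "\<Union>\<C> = {A. closed A \<and> A \<subseteq> Z}"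
    using topspace_fell[of Z] unfolding fell_def by simp
  define \<P> where "\<P> = {P. open P \<and> hit Z P \<in> \<C>}"
  define A where "A = Z - \<Union>\<P>"
  have "closed A" "A \<subseteq> Z"
    using assms by (auto simp: A_def \<P>_def closed_Diff compact_imp_closed)
  then obtain c where c: "c \<in> \<C>" "A \<in> c" using cover by blast
  have "\<nexists>P. open P \<and> c = hit Z P"
    using c by (auto simp: A_def \<P>_def hit_def)
  then obtain D where D: "closed D" "c = miss Z D"
    using subsetD[OF \<C> c(1)] by auto
  have "Z \<inter> D \<subseteq> \<Union>\<P>" using c D by (auto simp: miss_def A_def)
  moreover have "compact (Z \<inter> D)" using assms D by blast
  moreover have "\<forall>P\<in>\<P>. open P" by (simp add: \<P>_def)
  ultimately obtain \<P>' where \<P>': "\<P>' \<subseteq> \<P>" "finite \<P>'" "Z \<inter> D \<subseteq> \<Union>\<P>'"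
    by (meson compactE)
  let ?C = "insert c (hit Z ` \<P>')"
  have "?C \<subseteq> \<C>" using c \<P>' by (auto simp: \<P>_def)
  moreover have "\<Union>?C = {A. closed A \<and> A \<subseteq> Z}"
  proof
    show "\<Union>?C \<subseteq> {A. closed A \<and> A \<subseteq> Z}" using \<open>?C \<subseteq> \<C>\<close> cover by blast
    show "{A. closed A \<and> A \<subseteq> Z} \<subseteq> \<Union>?C"
      using \<P>'(3) by (fastforce simp: D(2) miss_def hit_def)
  qed
  ultimately show "\<exists>\<C>'. finite \<C>' \<and> \<C>' \<subseteq> \<C> \<and> \<Union>\<C>' = \<Union>?B"
    using \<P>'(2) cover \<open>\<Union>\<C> = \<Union>?B\<close> by (metis finite_imageI finite_insert)
qed

text \<open>
  Used for the Fell topology, with \<open>\<Gamma>\<close> the identity, and for the compact-open topology, with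
  \<open>\<Gamma>\<close> the graph.
\<close>

lemma closedin_pairwise:
  fixes \<Gamma> :: "'t \<Rightarrow> 'z::topological_space set"
  assumes hit: "\<And>P. open P \<Longrightarrow> openin X {t \<in> topspace X. \<Gamma> t \<inter> P \<noteq> {}}"
    and "closed Q"
  shows "closedin X {t \<in> topspace X. \<Gamma> t \<times> \<Gamma> t \<subseteq> Q}"
proof -
  let ?H = "\<lambda>P. {t \<in> topspace X. \<Gamma> t \<inter> P \<noteq> {}}"
  have "topspace X - {t \<in> topspace X. \<Gamma> t \<times> \<Gamma> t \<subseteq> Q} =
    \<Union>{?H P \<inter> ?H P' | P P'. open P \<and> open P' \<and> P \<times> P' \<subseteq> - Q}" (is "?L = ?R")
  proof
    show "?L \<subseteq> ?R"
    proof
      fix t assume "t \<in> ?L"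
      then obtain z z' where z: "t \<in> topspace X" "z \<in> \<Gamma> t" "z' \<in> \<Gamma> t" "(z, z') \<in> - Q" by auto
      moreover have "open (- Q)" using assms(2) by auto
      ultimately obtain P P' where "open P" "open P'" "z \<in> P" "z' \<in> P'" "P \<times> P' \<subseteq> - Q"
        using open_prod_elim[OF _ z(4)] by (metis mem_Sigma_iff)
      then have "t \<in> ?H P \<inter> ?H P'" "open P \<and> open P' \<and> P \<times> P' \<subseteq> - Q" using z by auto
      then show "t \<in> ?R" by blast
    qed
    show "?R \<subseteq> ?L" by fast
  qed
  moreover have "openin X ?R"
    using hit by (intro openin_Union) (auto intro!: openin_Int)
  ultimately show ?thesis by (auto simp: closedin_def)
qed


section \<open>Maps on the fibers of an open map\<close>

text \<open>
  Both spaces of maps on fibers have this form: \<open>R\<close> is \<open>UNIV\<close> for complex functions, and the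
  kernel relation of \<open>q\<close> for maps from fibers to fibers. In both cases \<open>R\<close> is closed.
\<close>

definition fiber_maps ::
  "('k::topological_space \<Rightarrow> 'l) \<Rightarrow> ('y::topological_space \<times> 'y) set \<Rightarrow> ('k \<rightharpoonup> 'y) set" where
  "fiber_maps q R = {\<theta> \<in> \<Union>l. cmaps (fiber q l) UNIV. ran \<theta> \<times> ran \<theta> \<subseteq> R}"

lemma C_q_eq_fiber_maps: "C_q q = fiber_maps q UNIV"
  by (auto simp: C_q_def fiber_maps_def)

lemma C_qq_eq_fiber_maps:
  assumes "surj q"
  shows "C_qq q = fiber_maps q {(y, z). q y = q z}"
proof
  show "C_qq q \<subseteq> fiber_maps q {(y, z). q y = q z}"
  proof
    fix \<theta> assume "\<theta> \<in> C_qq q"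
    then obtain l l' where "\<theta> \<in> cmaps (fiber q l) (fiber q l')" by (auto simp: C_qq_def)
    then have "\<theta> \<in> cmaps (fiber q l) UNIV" and ran: "ran \<theta> \<subseteq> fiber q l'"
      by (simp_all add: cmaps_def)
    moreover have "ran \<theta> \<times> ran \<theta> \<subseteq> {(y, z). q y = q z}"
      using subsetD[OF ran] by (simp add: fiber_def subset_iff)
    ultimately show "\<theta> \<in> fiber_maps q {(y, z). q y = q z}" by (auto simp: fiber_maps_def)
  qed
  show "fiber_maps q {(y, z). q y = q z} \<subseteq> C_qq q"
  proof
    fix \<theta> assume "\<theta> \<in> fiber_maps q {(y, z). q y = q z}"
    then obtain l where l: "\<theta> \<in> cmaps (fiber q l) UNIV" and R: "ran \<theta> \<times> ran \<theta> \<subseteq> {(y, z). q y = q z}"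
      by (auto simp: fiber_maps_def)
    obtain x where "q x = l" using assms by (metis surjD)
    then have "x \<in> dom \<theta>" using l by (simp add: cmaps_def fiber_def)
    then obtain y where "y \<in> ran \<theta>" by (auto simp: ran_def)
    then have "ran \<theta> \<subseteq> fiber q (q y)" using R by (auto simp: fiber_def)
    then show "\<theta> \<in> C_qq q" using l by (auto simp: C_qq_def cmaps_def)
  qed
qed

lemma in_graph_iff: "(x, y) \<in> Map.graph \<theta> \<longleftrightarrow> x \<in> dom \<theta> \<and> y = the (\<theta> x)"
  by (auto simp: Map.graph_def)

lemma restr_apply: "x \<in> A \<Longrightarrow> restr f A x = Some (f x)"
  by (simp add: restr_def)

lemma inj_graph: "inj Map.graph"
proof (rule injI, rule ext)
  fix m m' :: "'a \<rightharpoonup> 'b" and x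
  assume "Map.graph m = Map.graph m'"
  then have "m x = Some y \<longleftrightarrow> m' x = Some y" for y
    by (metis in_graphD in_graphI)
  then show "m x = m' x" by (metis option.exhaust)
qed

lemma restr_in_C_q:
  assumes "continuous_on UNIV f"
  shows "restr f (fiber q l) \<in> C_q q"
proof -
  have "continuous_on (fiber q l) (\<lambda>x. the (restr f (fiber q l) x))"
    by (subst continuous_on_cong[OF refl, where g = f])
      (auto simp: restr_def intro: continuous_on_subset[OF assms])
  then show ?thesis by (auto simp: C_q_def cmaps_def)
qed

locale open_fibration =
  fixes q :: "'k::{uniform_space,t2_space} \<Rightarrow> 'l::t2_space"
  assumes compact_dom: "compact (UNIV :: 'k set)"
    and continuous: "continuous_on UNIV q"
    and surj: "surj q"
    and open_map: "open_map euclidean euclidean q"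
begin

lemma closed_fiber: "closed (fiber q l)"
  unfolding fiber_def using continuous by (intro closed_vimage) auto

lemma compact_fiber: "compact (fiber q l)"
  using closed_fiber compact_dom by (metis compact_Int_closed inf_top_left)

lemma closed_kernel: "closed {(y, z). q y = q z}"
proof -
  have "continuous_on UNIV (q \<circ> fst)" "continuous_on UNIV (q \<circ> snd)"
    by (intro continuous_on_compose continuous_intros continuous_on_subset[OF continuous] subset_UNIV)+
  then show ?thesis
    using closed_Collect_eq[of "q \<circ> fst" "q \<circ> snd"] by (simp add: case_prod_unfold)
qed

lemma fiber_maps_dom:
  assumes "\<theta> \<in> fiber_maps q R"
  obtains l where "dom \<theta> = fiber q l" "source q \<theta> = l" "continuous_on (fiber q l) (\<lambda>x. the (\<theta> x))"
  using assms source_eq[OF surj, of \<theta>] by (auto simp: fiber_maps_def cmaps_def)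

lemma fiber_source: "\<theta> \<in> fiber_maps q R \<Longrightarrow> fiber q (source q \<theta>) = dom \<theta>"
  by (metis fiber_maps_dom)

lemma graph_compact:
  fixes \<theta> :: "'k \<rightharpoonup> 'y::topological_space"
  assumes "\<theta> \<in> fiber_maps q R"
  shows "compact (Map.graph \<theta>)"
proof -
  obtain l where "dom \<theta> = fiber q l" "continuous_on (fiber q l) (\<lambda>x. the (\<theta> x))"
    using fiber_maps_dom[OF assms] .
  then show ?thesis
    unfolding graph_eq_to_snd_dom
    by (auto intro!: compact_continuous_image continuous_intros compact_fiber)
qed

text \<open>
  So the compact-open topology is a miss topology on graphs. For \<open>O' = {}\<close> it controls the
  source: \<open>W q E (- G) {}\<close> consists of the maps whose fiber lies in \<open>G\<close>.
\<close>

lemma W_eq_graph: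
  assumes "E \<subseteq> fiber_maps q R"
  shows "W q E C O' = {\<theta> \<in> E. Map.graph \<theta> \<inter> C \<times> (- O') = {}}"
proof -
  have "(\<lambda>x. the (\<theta> x)) ` (C \<inter> fiber q (source q \<theta>)) \<subseteq> O' \<longleftrightarrow> Map.graph \<theta> \<inter> C \<times> (- O') = {}"
    if "\<theta> \<in> E" for \<theta>
  proof -
    have "fiber q (source q \<theta>) = dom \<theta>" using fiber_source that assms by blast
    moreover have "Map.graph \<theta> \<inter> C \<times> (- O') = {} \<longleftrightarrow> (\<forall>x y. (x, y) \<in> Map.graph \<theta> \<longrightarrow> x \<in> C \<longrightarrow> y \<in> O')"
      by blast
    ultimately show ?thesis unfolding in_graph_iff image_subset_iff by (simp only:) blast
  qed
  then show ?thesis by (auto simp: W_def)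
qed

lemma openin_W:
  assumes "closed C" "open O'"
  shows "openin (compact_open q E) (W q E C O')"
proof -
  have "compact C" using assms(1) compact_dom by (metis compact_Int_closed inf_top_left)
  then show ?thesis
    unfolding compact_open_def using assms by (intro topology_generated_by_Basis) blast
qed

lemma equicontinuous_family_iff_graph:
  fixes F :: "('k \<rightharpoonup> 'y::uniform_space) set"
  assumes "F \<subseteq> fiber_maps q R"
  shows "equicontinuous_family q F \<longleftrightarrow>
    (\<forall>U. entourage U \<longrightarrow> (\<exists>V. entourage V \<and>
       (\<forall>\<theta>\<in>F. \<forall>x y x' y'. (x, y) \<in> Map.graph \<theta> \<longrightarrow> (x', y') \<in> Map.graph \<theta> \<longrightarrow>
          (x, x') \<in> V \<longrightarrow> (y, y') \<in> U)))"
proof -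
  have "(\<forall>x1\<in>fiber q (source q \<theta>). \<forall>x2\<in>fiber q (source q \<theta>).
              (x1, x2) \<in> V \<longrightarrow> (the (\<theta> x1), the (\<theta> x2)) \<in> U) \<longleftrightarrow>
        (\<forall>x y x' y'. (x, y) \<in> Map.graph \<theta> \<longrightarrow> (x', y') \<in> Map.graph \<theta> \<longrightarrow>
          (x, x') \<in> V \<longrightarrow> (y, y') \<in> U)" if "\<theta> \<in> F" for \<theta> U V
  proof -
    have "fiber q (source q \<theta>) = dom \<theta>" using fiber_source that assms by blast
    then show ?thesis unfolding in_graph_iff by (simp only:) blast
  qed
  then show ?thesis unfolding equicontinuous_family_def by simp
qed

lemma equicontinuous_family_restr_iff:
  fixes f :: "'g \<Rightarrow> 'k \<Rightarrow> 'y::uniform_space"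
  shows "equicontinuous_family q {restr (f g) (fiber q l) | g l. True} \<longleftrightarrow>
    (\<forall>U. entourage U \<longrightarrow> (\<exists>V. entourage V \<and>
       (\<forall>g x y. q x = q y \<and> (x, y) \<in> V \<longrightarrow> (f g x, f g y) \<in> U)))"
proof -
  have src: "source q (restr (f g) (fiber q l)) = l" for g l
    by (rule source_eq[OF surj]) simp
  have "(\<forall>\<theta>\<in>{restr (f g) (fiber q l) | g l. True}. \<forall>x1\<in>fiber q (source q \<theta>).
      \<forall>x2\<in>fiber q (source q \<theta>). (x1, x2) \<in> V \<longrightarrow> (the (\<theta> x1), the (\<theta> x2)) \<in> U) \<longleftrightarrow>
    (\<forall>g x y. q x = q y \<and> (x, y) \<in> V \<longrightarrow> (f g x, f g y) \<in> U)"
    (is "?L \<longleftrightarrow> ?R") for U V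
  proof
    assume L: ?L
    show ?R
    proof (intro allI impI, elim conjE)
      fix g x y assume "q x = q y" "(x, y) \<in> V"
      then have xy: "x \<in> fiber q (q y)" "y \<in> fiber q (q y)" by (auto simp: fiber_def)
      have "restr (f g) (fiber q (q y)) \<in> {restr (f g) (fiber q l) | g l. True}" by blast
      from L[rule_format, OF this, unfolded src, OF xy \<open>(x, y) \<in> V\<close>]
      show "(f g x, f g y) \<in> U" using xy by (simp add: restr_apply)
    qed
  next
    assume R: ?R
    show ?L
    proof (intro ballI impI)
      fix \<theta> x y
      assume "\<theta> \<in> {restr (f g) (fiber q l) | g l. True}"
        and xy: "x \<in> fiber q (source q \<theta>)" "y \<in> fiber q (source q \<theta>)" "(x, y) \<in> V"
      then obtain g l where \<theta>: "\<theta> = restr (f g) (fiber q l)" by blast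
      have "x \<in> fiber q l" "y \<in> fiber q l" using xy by (simp_all add: \<theta> src)
      then show "(the (\<theta> x), the (\<theta> y)) \<in> U"
        using R xy(3) by (simp add: \<theta> restr_apply) (simp add: fiber_def)
    qed
  qed
  then show ?thesis unfolding equicontinuous_family_def by simp
qed


section \<open>Precompact families are equicontinuous\<close>

text \<open>
  The sets \<open>C x\<close> pin the values near each point \<open>x\<close> of the fiber of \<open>\<theta>\<close>, and \<open>G\<close> keeps the
  other fibers in the region covered by finitely many of them. Two close points of such a fiber
  then lie in a common \<open>C x\<close>.
\<close>

lemma equicontinuous_near:
  fixes E :: "('k \<rightharpoonup> 'y::uniform_space) set"
  assumes E: "E \<subseteq> fiber_maps q R" and "\<theta> \<in> E" "entourage U"
  shows "\<exists>N V. openin (compact_open q E) N \<and> \<theta> \<in> N \<and> entourage V \<and>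
    (\<forall>\<xi>\<in>N. \<forall>x y x' y'. (x, y) \<in> Map.graph \<xi> \<longrightarrow> (x', y') \<in> Map.graph \<xi> \<longrightarrow>
          (x, x') \<in> V \<longrightarrow> (y, y') \<in> U)"
proof -
  obtain l where l: "dom \<theta> = fiber q l" "continuous_on (fiber q l) (\<lambda>x. the (\<theta> x))"
    using fiber_maps_dom assms by (metis subsetD)
  have "\<exists>M C Y. open M \<and> closed C \<and> x \<in> M \<and> M \<subseteq> C \<and> open Y \<and> Y \<times> Y \<subseteq> U \<and>
      Map.graph \<theta> \<inter> C \<times> (- Y) = {}" if x: "x \<in> fiber q l" for x
  proof -
    obtain Y where Y: "open Y" "the (\<theta> x) \<in> Y" "Y \<times> Y \<subseteq> U"
      using entourage_square_nhd[OF assms(3)] .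
    obtain N where N: "open N" "x \<in> N" "\<And>x'. x' \<in> fiber q l \<Longrightarrow> x' \<in> N \<Longrightarrow> the (\<theta> x') \<in> Y"
      using l(2)[unfolded continuous_on_topological] x Y by metis
    obtain M C where MC: "open M" "closed C" "x \<in> M" "M \<subseteq> C" "C \<subseteq> N"
      using compact_t2_nested_nhd[OF compact_dom N(1,2)] .
    have "Map.graph \<theta> \<inter> N \<times> (- Y) = {}"
      using N(3) l(1) by (auto simp only: in_graph_iff)
    then have "Map.graph \<theta> \<inter> C \<times> (- Y) = {}" using MC(5) by blast
    then show ?thesis using Y(1,3) MC(1-4) by (intro exI[of _ M] exI[of _ C] exI[of _ Y]) simp
  qed
  then obtain M C Y where MCY: "\<And>x. x \<in> fiber q l \<Longrightarrow> open (M x) \<and> closed (C x) \<and> x \<in> M x \<and>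
      M x \<subseteq> C x \<and> open (Y x) \<and> Y x \<times> Y x \<subseteq> U \<and> Map.graph \<theta> \<inter> C x \<times> (- Y x) = {}"
    by metis
  obtain T G V where T: "finite T" "T \<subseteq> fiber q l" "open G" "fiber q l \<subseteq> G" "entourage V"
    "\<And>a b. a \<in> G \<Longrightarrow> (a, b) \<in> V \<Longrightarrow> \<exists>x\<in>T. a \<in> M x \<and> b \<in> M x"
    by (rule lebesgue_entourage[OF compact_fiber, of l M]) (use MCY in auto)
  define N where "N = \<Inter>(insert (W q E (- G) {}) ((\<lambda>x. W q E (C x) (Y x)) ` T))"
  have "openin (compact_open q E) N"
    unfolding N_def using T MCY by (intro openin_Inter) (auto intro!: openin_W)
  moreover have "\<theta> \<in> N"
  proof -
    have "Map.graph \<theta> \<inter> (- G) \<times> (- {}) = {}"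
      using T(4) l(1) by (auto simp only: in_graph_iff)
    moreover have "Map.graph \<theta> \<inter> C x \<times> (- Y x) = {}" if "x \<in> T" for x
      using MCY subsetD[OF T(2) that] by simp
    ultimately show ?thesis
      using \<open>\<theta> \<in> E\<close> by (simp add: N_def W_eq_graph[OF E])
  qed
  moreover have "(y, y') \<in> U"
    if "\<xi> \<in> N" "(x, y) \<in> Map.graph \<xi>" "(x', y') \<in> Map.graph \<xi>" "(x, x') \<in> V" for \<xi> x y x' y'
  proof -
    have "Map.graph \<xi> \<inter> (- G) \<times> UNIV = {}"
      using that(1) by (auto simp: N_def W_eq_graph[OF E])
    then have "x \<in> G" using that(2) by auto
    from T(6)[OF this that(4)] obtain t where t: "t \<in> T" "x \<in> M t" "x' \<in> M t" by blast
    then have *: "M t \<subseteq> C t" "Y t \<times> Y t \<subseteq> U" using MCY T(2) by auto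
    have "Map.graph \<xi> \<inter> C t \<times> (- Y t) = {}"
      using that(1) t by (auto simp: N_def W_eq_graph[OF E])
    moreover have "x \<in> C t" "x' \<in> C t" using t(2,3) *(1) by auto
    ultimately have "y \<in> Y t" "y' \<in> Y t" using that(2,3) by auto
    then show ?thesis using *(2) by auto
  qed
  ultimately show ?thesis using T(5) by blast
qed

lemma precompact_imp_equicontinuous:
  fixes E :: "('k \<rightharpoonup> 'y::uniform_space) set"
  assumes E: "E \<subseteq> fiber_maps q R" and F: "precompactin (compact_open q E) F"
  shows "equicontinuous_family q F"
proof -
  let ?X = "compact_open q E"
  let ?M = "?X closure_of F"
  have FE: "F \<subseteq> E" and M: "compactin ?X ?M"
    using F by (auto simp: precompactin_def topspace_compact_open)
  have FM: "F \<subseteq> ?M" using FE by (simp add: closure_of_subset topspace_compact_open)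
  have ME: "?M \<subseteq> E" using closure_of_subset_topspace topspace_compact_open by metis
  have FR: "F \<subseteq> fiber_maps q R" using FE E by blast
  show ?thesis
    unfolding equicontinuous_family_iff_graph[OF FR]
  proof (intro allI impI)
    fix U :: "('y \<times> 'y) set" assume "entourage U"
    let ?good = "\<lambda>V \<xi>. \<forall>x y x' y'. (x, y) \<in> Map.graph \<xi> \<longrightarrow> (x', y') \<in> Map.graph \<xi> \<longrightarrow>
          (x, x') \<in> V \<longrightarrow> (y, y') \<in> U"
    have "\<forall>\<theta>\<in>?M. \<exists>N V. openin ?X N \<and> \<theta> \<in> N \<and> entourage V \<and> (\<forall>\<xi>\<in>N. ?good V \<xi>)"
    proof
      fix \<theta> assume "\<theta> \<in> ?M"
      then have "\<theta> \<in> E" using ME by blast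
      then show "\<exists>N V. openin ?X N \<and> \<theta> \<in> N \<and> entourage V \<and> (\<forall>\<xi>\<in>N. ?good V \<xi>)"
        by (rule equicontinuous_near[OF E _ \<open>entourage U\<close>])
    qed
    from bchoice[OF this] obtain N where
      "\<forall>\<theta>\<in>?M. \<exists>V. openin ?X (N \<theta>) \<and> \<theta> \<in> N \<theta> \<and> entourage V \<and> (\<forall>\<xi>\<in>N \<theta>. ?good V \<xi>)" ..
    from bchoice[OF this] obtain V where
      NV: "\<forall>\<theta>\<in>?M. openin ?X (N \<theta>) \<and> \<theta> \<in> N \<theta> \<and> entourage (V \<theta>) \<and> (\<forall>\<xi>\<in>N \<theta>. ?good (V \<theta>) \<xi>)" ..
    have "\<exists>\<F>. finite \<F> \<and> \<F> \<subseteq> N ` ?M \<and> ?M \<subseteq> \<Union>\<F>"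
      by (intro compactinD[OF M]) (use NV in blast)+
    then obtain \<F> where \<F>: "finite \<F>" "\<F> \<subseteq> N ` ?M" "?M \<subseteq> \<Union>\<F>" by blast
    obtain T where T: "finite T" "T \<subseteq> ?M" "?M \<subseteq> \<Union>(N ` T)"
      using finite_subset_image[OF \<F>(1,2)] \<F>(3) by blast
    show "\<exists>V. entourage V \<and> (\<forall>\<theta>\<in>F. ?good V \<theta>)"
    proof (intro exI conjI ballI)
      show "entourage {p. \<forall>\<theta>\<in>T. p \<in> V \<theta>}"
        using T(1,2) NV by (intro entourage_INT) blast+
      fix \<theta> assume "\<theta> \<in> F"
      then obtain t where t: "t \<in> T" "\<theta> \<in> N t" using FM T(3) by blast
      then have "?good (V t) \<theta>" using NV T(2) by blast
      then show "?good {p. \<forall>\<theta>\<in>T. p \<in> V \<theta>} \<theta>" using t(1) by simp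
    qed
  qed
qed


section \<open>Equicontinuous families are precompact\<close>

text \<open>
  Let the graph of \<open>\<theta>\<close> meet \<open>P\<close> at \<open>(x, y)\<close>. Keeping the values over a closed neighborhood
  \<open>C\<close> of \<open>x\<close> near \<open>y\<close> is not sufficient, since a fiber may avoid \<open>C\<close>; openness of \<open>q\<close>
  ensures that the fibers close to that of \<open>x\<close> do meet \<open>C\<close>.
\<close>

lemma openin_compact_open_hit:
  fixes E :: "('k \<rightharpoonup> 'y::topological_space) set"
  assumes E: "E \<subseteq> fiber_maps q R" and "open P"
  shows "openin (compact_open q E) {\<theta> \<in> topspace (compact_open q E). Map.graph \<theta> \<inter> P \<noteq> {}}"
proof (subst openin_subopen, intro ballI)
  let ?H = "{\<theta> \<in> topspace (compact_open q E). Map.graph \<theta> \<inter> P \<noteq> {}}"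
  fix \<theta> assume "\<theta> \<in> ?H"
  then obtain x y where \<theta>: "\<theta> \<in> E" and xy: "(x, y) \<in> Map.graph \<theta>" "(x, y) \<in> P"
    by (auto simp: topspace_compact_open)
  obtain l where l: "dom \<theta> = fiber q l" "continuous_on (fiber q l) (\<lambda>x. the (\<theta> x))"
    using fiber_maps_dom subsetD[OF E \<theta>] by metis
  have x: "x \<in> fiber q l" "y = the (\<theta> x)" using xy(1) l(1) by (auto simp only: in_graph_iff)
  obtain N Y where NY: "open N" "open Y" "x \<in> N" "y \<in> Y" "N \<times> Y \<subseteq> P"
    by (rule open_prod_elim[OF \<open>open P\<close> xy(2)]) auto
  obtain N' where N': "open N'" "x \<in> N'" "\<And>x'. x' \<in> fiber q l \<Longrightarrow> x' \<in> N' \<Longrightarrow> the (\<theta> x') \<in> Y"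
    using l(2)[unfolded continuous_on_topological] x NY(2,4) by metis
  obtain M C where MC: "open M" "closed C" "x \<in> M" "M \<subseteq> C" "C \<subseteq> N \<inter> N'"
    by (rule compact_t2_nested_nhd[OF compact_dom, of "N \<inter> N'" x]) (use NY(1,3) N'(1,2) in auto)
  \<comment> \<open>Maps whose fiber meets \<open>M\<close>: an open condition since \<open>q\<close> is open.\<close>
  define S where "S = q -` (q ` M)"
  have "open (q ` M)" using open_map MC(1) by (auto simp: open_map_def)
  then have "open S" using continuous by (simp add: S_def open_vimage)
  then have "openin (compact_open q E) (W q E C Y \<inter> W q E (- S) {})"
    using MC(2) NY(2) by (intro openin_Int openin_W) auto
  moreover have "\<theta> \<in> W q E C Y \<inter> W q E (- S) {}"
  proof -
    have "the (\<theta> a) \<in> Y" if "a \<in> C" "a \<in> dom \<theta>" for a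
      using N'(3)[of a] subsetD[OF MC(5) that(1)] that(2) l(1) by simp
    then have "Map.graph \<theta> \<inter> C \<times> (- Y) = {}" by (auto simp only: in_graph_iff)
    moreover have "fiber q l \<subseteq> S" using x(1) MC(3) by (auto simp: S_def fiber_def)
    then have "Map.graph \<theta> \<inter> (- S) \<times> (- {}) = {}"
      using l(1) by (auto simp only: in_graph_iff)
    ultimately show ?thesis using \<theta> by (simp add: W_eq_graph[OF E])
  qed
  moreover have "W q E C Y \<inter> W q E (- S) {} \<subseteq> ?H"
  proof
    fix \<xi> assume "\<xi> \<in> W q E C Y \<inter> W q E (- S) {}"
    then have \<xi>: "\<xi> \<in> E" "Map.graph \<xi> \<inter> C \<times> (- Y) = {}" "Map.graph \<xi> \<inter> (- S) \<times> UNIV = {}"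
      by (auto simp: W_eq_graph[OF E])
    obtain l' where l': "dom \<xi> = fiber q l'"
      using fiber_maps_dom subsetD[OF E \<xi>(1)] by metis
    obtain a where "q a = l'" using surj by (metis surjD)
    then have "a \<in> dom \<xi>" using l' by (simp add: fiber_def)
    then have "(a, the (\<xi> a)) \<in> Map.graph \<xi>" by (simp only: in_graph_iff)
    then have "a \<in> S" using \<xi>(3) by blast
    then obtain b where b: "b \<in> M" "q b = l'" using \<open>q a = l'\<close> by (auto simp: S_def)
    then have "b \<in> dom \<xi>" using l' by (simp add: fiber_def)
    then have g: "(b, the (\<xi> b)) \<in> Map.graph \<xi>" by (simp only: in_graph_iff)
    then have "the (\<xi> b) \<in> Y" using \<xi>(2) b(1) MC(4) by blast
    then have "(b, the (\<xi> b)) \<in> P" using b(1) MC(4,5) NY(5) by blast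
    then show "\<xi> \<in> ?H" using g \<xi>(1) by (auto simp: topspace_compact_open)
  qed
  ultimately show "\<exists>T. openin (compact_open q E) T \<and> \<theta> \<in> T \<and> T \<subseteq> ?H" by blast
qed

text \<open>
  The empty set is excluded: it is the graph of no map on a fiber, fibers being nonempty.
\<close>

definition saturated :: "('k \<times> 'y) set \<Rightarrow> bool" where
  "saturated A \<longleftrightarrow> A \<noteq> {} \<and> (\<forall>x\<in>fst ` A. \<forall>x'. q x' = q x \<longrightarrow> x' \<in> fst ` A)"

lemma closedin_fell_saturated:
  fixes Z :: "('k \<times> 'y::t2_space) set"
  assumes "compact Z"
  shows "closedin (fell Z) {A \<in> topspace (fell Z). saturated A}"
proof -
  let ?S = "{A \<in> topspace (fell Z). saturated A}"
  have "openin (fell Z) (topspace (fell Z) - ?S)"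
  proof (subst openin_subopen, intro ballI)
    fix A assume "A \<in> topspace (fell Z) - ?S"
    then have A: "closed A" "A \<subseteq> Z" "\<not> saturated A" by (auto simp: topspace_fell)
    show "\<exists>T. openin (fell Z) T \<and> A \<in> T \<and> T \<subseteq> topspace (fell Z) - ?S"
    proof (cases "A = {}")
      case True
      have "openin (fell Z) (miss Z UNIV)" by (intro openin_miss) simp
      moreover have "A \<in> miss Z UNIV" using A True by (simp add: miss_def)
      moreover have "miss Z UNIV \<subseteq> topspace (fell Z) - ?S"
        by (auto simp: miss_def topspace_fell saturated_def)
      ultimately show ?thesis by blast
    next
      case False
      then obtain x y x' where x: "(x, y) \<in> A" "q x' = q x" "x' \<notin> fst ` A"
        using A(3) by (auto simp: saturated_def)
      have "compact A" using A assms by (metis compact_Int_closed inf.absorb_iff2)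
      then have "compact (fst ` A)" by (intro compact_continuous_image continuous_intros)
      then have "open (- fst ` A)" using compact_imp_closed by blast
      then obtain M C where MC: "open M" "closed C" "x' \<in> M" "M \<subseteq> C" "C \<subseteq> - fst ` A"
        using compact_t2_nested_nhd[OF compact_dom, of "- fst ` A" x'] x(3) by blast
      \<comment> \<open>By openness of \<open>q\<close>, a closed set that meets a small neighborhood of \<open>(x, y)\<close> has a
          point over \<open>q ` M\<close>; so it is not saturated if it misses \<open>C\<close>.\<close>
      define S where "S = q -` (q ` M)"
      have "open (q ` M)" using open_map MC(1) by (auto simp: open_map_def)
      then have "open S" using continuous by (simp add: S_def open_vimage)
      then have "openin (fell Z) (hit Z (S \<times> UNIV) \<inter> miss Z (C \<times> UNIV))"
        using MC(2) by (intro openin_Int openin_hit openin_miss open_Times closed_Times) auto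
      moreover have "A \<in> hit Z (S \<times> UNIV) \<inter> miss Z (C \<times> UNIV)"
      proof -
        have "x \<in> S" using x(2) MC(3) by (metis S_def image_eqI vimageI)
        then have "A \<inter> S \<times> UNIV \<noteq> {}" using x(1) by blast
        moreover have "A \<inter> C \<times> UNIV = {}" using MC(5) by force
        ultimately show ?thesis using A by (simp add: hit_def miss_def)
      qed
      moreover have "hit Z (S \<times> UNIV) \<inter> miss Z (C \<times> UNIV) \<subseteq> topspace (fell Z) - ?S"
      proof
        fix B assume "B \<in> hit Z (S \<times> UNIV) \<inter> miss Z (C \<times> UNIV)"
        then have B: "closed B" "B \<subseteq> Z" "B \<inter> S \<times> UNIV \<noteq> {}" "B \<inter> C \<times> UNIV = {}"
          by (simp_all add: hit_def miss_def)
        then obtain a b where "(a, b) \<in> B" "a \<in> S" by blast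
        then obtain c where c: "c \<in> M" "q c = q a" by (auto simp: S_def)
        have "c \<notin> fst ` B" using c(1) MC(4) B(4) by force
        moreover have "a \<in> fst ` B" using \<open>(a, b) \<in> B\<close> by force
        ultimately have "\<not> saturated B" using c(2) unfolding saturated_def by blast
        then show "B \<in> topspace (fell Z) - ?S" using B by (simp add: topspace_fell)
      qed
      ultimately show ?thesis by blast
    qed
  qed
  then show ?thesis by (auto simp: closedin_def)
qed

text \<open>
  Equicontinuity is a property of pairs of points on a common graph, and it survives the passage
  to the closure at the cost of shrinking the entourages. This is why a single closed set of pairs
  can encode equicontinuity.
\<close>

lemma closure_graphs_equicontinuous:
  fixes F :: "('k \<rightharpoonup> 'y::uniform_space) set"
  assumes F: "F \<subseteq> fiber_maps q R" "equicontinuous_family q F" and "entourage U"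
  obtains V where "entourage V"
    "\<And>x y x' y'. ((x, y), (x', y')) \<in> closure (\<Union>\<theta>\<in>F. Map.graph \<theta> \<times> Map.graph \<theta>) \<Longrightarrow>
       (x, x') \<in> V \<Longrightarrow> (y, y') \<in> U"
proof -
  obtain D where D: "entourage D" "sym D" "D O D O D \<subseteq> U" using entourage_sym_cube[OF assms(3)] .
  obtain V' where V': "entourage V'" "\<And>\<theta> x y x' y'. \<theta> \<in> F \<Longrightarrow> (x, y) \<in> Map.graph \<theta> \<Longrightarrow>
      (x', y') \<in> Map.graph \<theta> \<Longrightarrow> (x, x') \<in> V' \<Longrightarrow> (y, y') \<in> D"
    using F(2)[unfolded equicontinuous_family_iff_graph[OF F(1)], rule_format, OF D(1)] by blast
  obtain V where V: "entourage V" "sym V" "V O V O V \<subseteq> V'" using entourage_sym_cube[OF V'(1)] .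
  show ?thesis
  proof (rule that[OF V(1)])
    let ?Q = "\<Union>\<theta>\<in>F. Map.graph \<theta> \<times> Map.graph \<theta>"
    fix x y x' y' assume Q: "((x, y), (x', y')) \<in> closure ?Q" and "(x, x') \<in> V"
    obtain N where N: "open N" "x \<in> N" "\<And>a. a \<in> N \<Longrightarrow> (x, a) \<in> V" using entourage_nhd[OF V(1)] by metis
    obtain N' where N': "open N'" "x' \<in> N'" "\<And>a. a \<in> N' \<Longrightarrow> (x', a) \<in> V" using entourage_nhd[OF V(1)] by metis
    obtain Y where Y: "open Y" "y \<in> Y" "\<And>a. a \<in> Y \<Longrightarrow> (y, a) \<in> D" using entourage_nhd[OF D(1)] by metis
    obtain Y' where Y': "open Y'" "y' \<in> Y'" "\<And>a. a \<in> Y' \<Longrightarrow> (y', a) \<in> D" using entourage_nhd[OF D(1)] by metis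
    have "open ((N \<times> Y) \<times> (N' \<times> Y'))" using N N' Y Y' by (intro open_Times)
    moreover have "((x, y), (x', y')) \<in> (N \<times> Y) \<times> (N' \<times> Y')" using N N' Y Y' by blast
    ultimately have "(N \<times> Y) \<times> (N' \<times> Y') \<inter> ?Q \<noteq> {}"
      using Q open_Int_closure_eq_empty[of "(N \<times> Y) \<times> (N' \<times> Y')" ?Q] by blast
    then obtain \<theta> a b a' b' where ab: "\<theta> \<in> F" "(a, b) \<in> Map.graph \<theta>" "(a', b') \<in> Map.graph \<theta>"
      "a \<in> N" "b \<in> Y" "a' \<in> N'" "b' \<in> Y'" by auto
    have "(a, x) \<in> V" using N(3)[OF ab(4)] V(2) by (auto dest: symD)
    moreover have "(x', a') \<in> V" using N'(3)[OF ab(6)] .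
    ultimately have "(a, a') \<in> V'" using \<open>(x, x') \<in> V\<close> V(3) by blast
    then have "(b, b') \<in> D" using V'(2)[OF ab(1-3)] by simp
    moreover have "(y, b) \<in> D" using Y(3)[OF ab(5)] .
    moreover have "(b', y') \<in> D" using Y'(3)[OF ab(7)] D(2) by (auto dest: symD)
    ultimately show "(y, y') \<in> U" using D(3) by blast
  qed
qed

lemma saturated_graph:
  assumes "\<theta> \<in> fiber_maps q R"
  shows "saturated (Map.graph \<theta>)"
proof -
  obtain l where l: "dom \<theta> = fiber q l" using fiber_maps_dom[OF assms] .
  obtain x where "q x = l" using surj by (metis surjD)
  then have "x \<in> dom \<theta>" using l by (simp add: fiber_def)
  then have "(x, the (\<theta> x)) \<in> Map.graph \<theta>" by (simp only: in_graph_iff)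
  then show ?thesis
    using l by (auto simp: saturated_def fst_graph_eq_dom fiber_def)
qed

text \<open>
  Single-valuedness is a case of equicontinuity: two values over the same point are within every
  entourage.
\<close>

lemma saturated_imp_graph:
  fixes A :: "('k \<times> 'y::{uniform_space,t2_space}) set"
  assumes "saturated A"
    and ker: "\<And>x y x' y'. (x, y) \<in> A \<Longrightarrow> (x', y') \<in> A \<Longrightarrow> q x = q x'"
    and R: "snd ` A \<times> snd ` A \<subseteq> R"
    and equi: "\<And>U. entourage U \<Longrightarrow> \<exists>V. entourage V \<and> (\<forall>x y x' y'. (x, y) \<in> A \<longrightarrow> (x', y') \<in> A \<longrightarrow>
        (x, x') \<in> V \<longrightarrow> (y, y') \<in> U)"
  obtains \<theta> where "\<theta> \<in> fiber_maps q R" "Map.graph \<theta> = A"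
proof -
  have unique: "y = y'" if "(x, y) \<in> A" "(x, y') \<in> A" for x y y'
  proof (rule entourages_separate)
    fix U :: "('y \<times> 'y) set" assume "entourage U"
    then obtain V where "entourage V" "\<forall>x y x' y'. (x, y) \<in> A \<longrightarrow> (x', y') \<in> A \<longrightarrow>
        (x, x') \<in> V \<longrightarrow> (y, y') \<in> U" using equi by blast
    then show "(y, y') \<in> U" using that entourage_refl[of V x] by blast
  qed
  define \<theta> where "\<theta> x = (if x \<in> fst ` A then Some (THE y. (x, y) \<in> A) else None)" for x
  have \<theta>_eq: "\<theta> x = Some y" if "(x, y) \<in> A" for x y
  proof -
    have "(THE y. (x, y) \<in> A) = y" using that unique by (intro the_equality)
    then show ?thesis using that by (force simp: \<theta>_def)
  qed
  have graph: "Map.graph \<theta> = A"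
  proof (rule set_eqI)
    fix p :: "'k \<times> 'y"
    obtain x y where p: "p = (x, y)" by fastforce
    have "(x, y) \<in> A" if "\<theta> x = Some y"
    proof -
      have "x \<in> fst ` A" using that by (simp add: \<theta>_def split: if_splits)
      then obtain z where z: "(x, z) \<in> A" by auto
      then show ?thesis using \<theta>_eq[OF z] that by simp
    qed
    then show "p \<in> Map.graph \<theta> \<longleftrightarrow> p \<in> A" using \<theta>_eq by (auto simp: p Map.graph_def)
  qed
  have "dom \<theta> = fst ` A" using graph fst_graph_eq_dom by metis
  obtain x0 y0 where "(x0, y0) \<in> A" using assms(1) by (auto simp: saturated_def)
  have dom: "dom \<theta> = fiber q (q x0)"
  proof
    show "dom \<theta> \<subseteq> fiber q (q x0)"
    proof
      fix x assume "x \<in> dom \<theta>"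
      then obtain y where "(x, y) \<in> A" unfolding \<open>dom \<theta> = fst ` A\<close> by auto
      from ker[OF this \<open>(x0, y0) \<in> A\<close>] show "x \<in> fiber q (q x0)" by (simp add: fiber_def)
    qed
    show "fiber q (q x0) \<subseteq> dom \<theta>"
    proof
      fix x assume "x \<in> fiber q (q x0)"
      moreover have "x0 \<in> fst ` A" using \<open>(x0, y0) \<in> A\<close> by force
      ultimately show "x \<in> dom \<theta>"
        using assms(1) unfolding saturated_def \<open>dom \<theta> = fst ` A\<close> fiber_def by blast
    qed
  qed
  have in_A: "(x, the (\<theta> x)) \<in> A" if "x \<in> fiber q (q x0)" for x
    using that unfolding graph[symmetric] in_graph_iff dom by simp
  have "continuous_on (fiber q (q x0)) (\<lambda>x. the (\<theta> x))"
    unfolding continuous_on_topological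
  proof (intro ballI allI impI)
    fix x B assume x: "x \<in> fiber q (q x0)" and B: "open B" "the (\<theta> x) \<in> B"
    obtain U where U: "entourage U" "\<And>y. (the (\<theta> x), y) \<in> U \<Longrightarrow> y \<in> B"
      using open_entourage[OF B] by metis
    obtain V where V: "entourage V" "\<forall>x y x' y'. (x, y) \<in> A \<longrightarrow> (x', y') \<in> A \<longrightarrow>
        (x, x') \<in> V \<longrightarrow> (y, y') \<in> U" using equi[OF U(1)] by blast
    obtain N where N: "open N" "x \<in> N" "\<And>a. a \<in> N \<Longrightarrow> (x, a) \<in> V"
      using entourage_nhd[OF V(1)] by metis
    have "the (\<theta> a) \<in> B" if "a \<in> fiber q (q x0)" "a \<in> N" for a
      using V(2)[rule_format, OF in_A[OF x] in_A[OF that(1)] N(3)[OF that(2)]] by (rule U(2))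
    then show "\<exists>N. open N \<and> x \<in> N \<and> (\<forall>a\<in>fiber q (q x0). a \<in> N \<longrightarrow> the (\<theta> a) \<in> B)"
      using N(1,2) by blast
  qed
  then have "\<theta> \<in> cmaps (fiber q (q x0)) UNIV" using dom by (simp add: cmaps_def)
  moreover have "ran \<theta> = snd ` A" using graph snd_graph_ran by metis
  ultimately have "\<theta> \<in> fiber_maps q R" using R by (auto simp: fiber_maps_def)
  then show ?thesis using graph that by blast
qed

lemma equicontinuous_imp_precompact:
  fixes F :: "('k \<rightharpoonup> 'y::{uniform_space,t2_space}) set"
  assumes "closed R" and F: "F \<subseteq> fiber_maps q R" "equicontinuous_family q F"
    and "compact B" and ran: "\<And>\<theta>. \<theta> \<in> F \<Longrightarrow> ran \<theta> \<subseteq> B"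
  shows "precompactin (compact_open q (fiber_maps q R)) F"
proof -
  let ?E = "fiber_maps q R"
  let ?X = "compact_open q ?E"
  define Q where "Q = closure (\<Union>\<theta>\<in>F. Map.graph \<theta> \<times> Map.graph \<theta>)"
  define Z where "Z = (UNIV :: 'k set) \<times> B"
  have Z: "compact Z" unfolding Z_def by (intro compact_Times compact_dom \<open>compact B\<close>)
  define \<G> where "\<G> = {A \<in> topspace (fell Z). A \<times> A \<subseteq> Q} \<inter> {A \<in> topspace (fell Z). saturated A}"
  define M where "M = {\<theta> \<in> topspace ?X. Map.graph \<theta> \<times> Map.graph \<theta> \<subseteq> Q}"

  \<comment> \<open>\<open>Q\<close> inherits from the family every closed property of pairs of points on a graph.\<close>
  have Q_sub: "Q \<subseteq> S" if "closed S" "\<And>\<theta>. \<theta> \<in> F \<Longrightarrow> Map.graph \<theta> \<times> Map.graph \<theta> \<subseteq> S" for S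
    unfolding Q_def using that by (intro closure_minimal UN_least)
  have Q_Z: "Q \<subseteq> Z \<times> Z"
  proof (rule Q_sub)
    show "closed (Z \<times> Z)" using Z by (intro closed_Times compact_imp_closed)
    show "Map.graph \<theta> \<times> Map.graph \<theta> \<subseteq> Z \<times> Z" if "\<theta> \<in> F" for \<theta>
    proof -
      have "p \<in> Z" if "p \<in> Map.graph \<theta>" for p
        using ran[OF \<open>\<theta> \<in> F\<close>] graph_ranD[OF that] by (cases p) (auto simp: Z_def)
      then show ?thesis by blast
    qed
  qed
  have Q_ker: "Q \<subseteq> {p. q (fst (fst p)) = q (fst (snd p))}"
  proof (rule Q_sub)
    have "continuous_on UNIV (\<lambda>p::('k \<times> 'y) \<times> ('k \<times> 'y). q (fst (fst p)))"
      "continuous_on UNIV (\<lambda>p::('k \<times> 'y) \<times> ('k \<times> 'y). q (fst (snd p)))"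
      by (rule continuous_on_compose2[OF continuous]; intro continuous_intros subset_UNIV)+
    then show "closed {p::('k \<times> 'y) \<times> ('k \<times> 'y). q (fst (fst p)) = q (fst (snd p))}"
      by (rule closed_Collect_eq)
    fix \<theta> assume "\<theta> \<in> F"
    then obtain l where "dom \<theta> = fiber q l" using fiber_maps_dom F(1) by (metis subsetD)
    then have "q (fst p) = l" if "p \<in> Map.graph \<theta>" for p
      using graph_domD[OF that] by (simp add: fiber_def)
    then show "Map.graph \<theta> \<times> Map.graph \<theta> \<subseteq> {p. q (fst (fst p)) = q (fst (snd p))}"
      by auto
  qed
  have Q_R: "Q \<subseteq> (\<lambda>p. (snd (fst p), snd (snd p))) -` R"
  proof (rule Q_sub)
    show "closed ((\<lambda>p::('k \<times> 'y) \<times> ('k \<times> 'y). (snd (fst p), snd (snd p))) -` R)"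
      by (intro closed_vimage \<open>closed R\<close> continuous_intros)
    show "Map.graph \<theta> \<times> Map.graph \<theta> \<subseteq> (\<lambda>p. (snd (fst p), snd (snd p))) -` R" if "\<theta> \<in> F" for \<theta>
    proof -
      have "ran \<theta> \<times> ran \<theta> \<subseteq> R" using F(1) that by (auto simp: fiber_maps_def)
      then have "(snd a, snd b) \<in> R" if "a \<in> Map.graph \<theta>" "b \<in> Map.graph \<theta>" for a b
        using graph_ranD[OF that(1)] graph_ranD[OF that(2)] by blast
      then show ?thesis by auto
    qed
  qed

  have graph_image: "\<G> = Map.graph ` M"
  proof
    show "Map.graph ` M \<subseteq> \<G>"
    proof
      fix A assume "A \<in> Map.graph ` M"
      then obtain \<theta> where \<theta>: "\<theta> \<in> ?E" "A = Map.graph \<theta>" "A \<times> A \<subseteq> Q"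
        by (auto simp: M_def topspace_compact_open)
      have "closed A" using graph_compact[OF \<theta>(1)] \<theta>(2) compact_imp_closed by blast
      moreover have "A \<subseteq> Z" using \<theta>(3) Q_Z by blast
      moreover have "saturated A" using saturated_graph[OF \<theta>(1)] \<theta>(2) by simp
      ultimately show "A \<in> \<G>" using \<theta>(3) by (simp add: \<G>_def topspace_fell)
    qed
    show "\<G> \<subseteq> Map.graph ` M"
    proof
      fix A assume "A \<in> \<G>"
      then have A: "A \<times> A \<subseteq> Q" "saturated A" by (simp_all add: \<G>_def)
      obtain \<theta> where "\<theta> \<in> ?E" "Map.graph \<theta> = A"
      proof (rule saturated_imp_graph[OF A(2)])
        show "q x = q x'" if "(x, y) \<in> A" "(x', y') \<in> A" for x y x' y'
          using subsetD[OF Q_ker subsetD[OF A(1)], of "((x, y), (x', y'))"] that by simp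
        show "snd ` A \<times> snd ` A \<subseteq> R" using subset_trans[OF A(1) Q_R] by auto
        fix U :: "('y \<times> 'y) set" assume "entourage U"
        then obtain V where V: "entourage V"
          "\<And>x y x' y'. ((x, y), (x', y')) \<in> Q \<Longrightarrow> (x, x') \<in> V \<Longrightarrow> (y, y') \<in> U"
          unfolding Q_def by (rule closure_graphs_equicontinuous[OF F]) blast
        show "\<exists>V. entourage V \<and> (\<forall>x y x' y'. (x, y) \<in> A \<longrightarrow> (x', y') \<in> A \<longrightarrow>
          (x, x') \<in> V \<longrightarrow> (y, y') \<in> U)"
        proof (intro exI[of _ V] conjI V(1) allI impI)
          fix x y x' y' assume "(x, y) \<in> A" "(x', y') \<in> A" "(x, x') \<in> V"
          then show "(y, y') \<in> U" using A(1) by (intro V(2)[of x y x' y']) auto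
        qed
      qed
      then show "A \<in> Map.graph ` M" using A(1) by (auto simp: M_def topspace_compact_open)
    qed
  qed

  have "closed Q" by (simp add: Q_def)
  have "closedin (fell Z) {A \<in> topspace (fell Z). A \<times> A \<subseteq> Q}"
  proof (rule closedin_pairwise[OF _ \<open>closed Q\<close>])
    fix P :: "('k \<times> 'y) set" assume "open P"
    then show "openin (fell Z) {A \<in> topspace (fell Z). A \<inter> P \<noteq> {}}"
      using openin_hit[of P Z] by (simp add: topspace_fell hit_def conj_assoc)
  qed
  then have "closedin (fell Z) \<G>"
    unfolding \<G>_def using closedin_fell_saturated[OF Z] by (rule closedin_Int)
  then have \<G>: "compactin (fell Z) \<G>"
    using compact_space_fell[OF Z] by (rule closedin_compact_space[rotated])

  have top: "topspace (subtopology (fell Z) \<G>) = \<G>"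
    unfolding topspace_subtopology \<G>_def by blast
  have cont: "continuous_map (subtopology (fell Z) \<G>) ?X (inv Map.graph)"
    unfolding compact_open_def
  proof (rule continuous_on_generated_topo)
    fix U assume "U \<in> {W q ?E C O' | C O'. compact C \<and> open O'}"
    then obtain C O' where U: "U = W q ?E C O'" "compact C" "open O'" by blast
    have "inv Map.graph -` U \<inter> \<G> = \<G> \<inter> miss Z (C \<times> (- O'))"
    proof -
      have "inv Map.graph A \<in> U \<longleftrightarrow> A \<in> miss Z (C \<times> (- O'))" if "A \<in> \<G>" for A
      proof -
        obtain \<theta> where "\<theta> \<in> ?E" "A = Map.graph \<theta>"
          using \<open>A \<in> \<G>\<close> by (auto simp: graph_image M_def topspace_compact_open)
        moreover have "closed A" "A \<subseteq> Z" using that by (simp_all add: \<G>_def topspace_fell)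
        ultimately show ?thesis
          by (simp add: U(1) inv_f_f[OF inj_graph] W_eq_graph[OF order_refl] miss_def)
      qed
      then show ?thesis unfolding vimage_def by blast
    qed
    moreover have "openin (fell Z) (miss Z (C \<times> (- O')))"
      using compact_imp_closed[OF U(2)] U(3) by (intro openin_miss closed_Times) auto
    ultimately show "openin (subtopology (fell Z) \<G>)
        (inv Map.graph -` U \<inter> topspace (subtopology (fell Z) \<G>))"
      unfolding top openin_subtopology by (metis Int_commute)
  next
    have "inv Map.graph A \<in> ?E" if "A \<in> \<G>" for A
      using that by (auto simp: graph_image M_def topspace_compact_open inv_f_f[OF inj_graph])
    then show "inv Map.graph ` topspace (subtopology (fell Z) \<G>) \<subseteq> \<Union>{W q ?E C O' | C O'. compact C \<and> open O'}"
      using topspace_compact_open[of q ?E] unfolding compact_open_def top topology_generated_by_topspace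
      by (simp add: image_subset_iff)
  qed
  have "compactin (subtopology (fell Z) \<G>) \<G>" using \<G> by (simp add: compactin_subtopology)
  from image_compactin[OF this cont] have "compactin ?X (inv Map.graph ` \<G>)" .
  then have cpt: "compactin ?X M"
    by (simp add: graph_image image_image inv_f_f[OF inj_graph])
  have cl: "closedin ?X M"
    unfolding M_def
    by (intro closedin_pairwise openin_compact_open_hit[OF order_refl] \<open>closed Q\<close>)
  have FM: "F \<subseteq> M"
  proof
    fix \<theta> assume "\<theta> \<in> F"
    then have "Map.graph \<theta> \<times> Map.graph \<theta> \<subseteq> (\<Union>\<theta>\<in>F. Map.graph \<theta> \<times> Map.graph \<theta>)" by (rule UN_upper)
    also have "\<dots> \<subseteq> Q" unfolding Q_def by (rule closure_subset)
    finally show "\<theta> \<in> M" using subsetD[OF F(1) \<open>\<theta> \<in> F\<close>] by (simp add: M_def topspace_compact_open)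
  qed
  have "compactin ?X (?X closure_of F)"
    using closed_compactin[OF cpt closure_of_minimal[OF FM cl] closedin_closure_of] .
  then show ?thesis using F(1) by (simp add: precompactin_def topspace_compact_open)
qed

end

theorem theorem7p1:
  fixes \<phi> :: "'g::{topological_group_add,t2_space} \<Rightarrow> 'k::{uniform_space,t2_space} \<Rightarrow> 'k"
    and \<psi> :: "'g \<Rightarrow> 'l::t2_space \<Rightarrow> 'l"
    and q :: "'k \<Rightarrow> 'l"
  assumes "open_tds_extension \<phi> \<psi> q"
  defines "a \<equiv> equicontinuous_extension \<phi> q"
    and "b \<equiv> precompactin (compact_open q (C_qq q)) {restr (\<phi> g) (fiber q l) | g l. True}"
    and "c \<equiv> (\<forall>f. continuous_on UNIV f \<longrightarrow>
               equicontinuous_family q {restr (koopman \<phi> g f) (fiber q l) | g l. True})"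
    and "d \<equiv> (\<forall>f. continuous_on UNIV f \<longrightarrow>
               precompactin (compact_open q (C_q q)) {restr (koopman \<phi> g f) (fiber q l) | g l. True})"
  shows "(a \<longleftrightarrow> b) \<and> (b \<longleftrightarrow> c) \<and> (c \<longleftrightarrow> d)"
proof -
  have ext: "tds_extension \<phi> \<psi> q" and "open_map euclidean euclidean q"
    using assms(1) by (auto simp: open_tds_extension_def)
  then interpret open_fibration q
    by unfold_locales (auto simp: tds_extension_def tds_def)
  have \<phi>: "continuous_on UNIV (\<phi> g)" for g
  proof -
    have "continuous_on UNIV (\<lambda>(g, x). \<phi> g x)" using ext by (simp add: tds_extension_def tds_def)
    from continuous_on_compose2[OF this, of UNIV "\<lambda>x. (g, x)"] show ?thesis
      by (simp add: continuous_on_Pair)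
  qed
  have a_iff: "a \<longleftrightarrow> equicontinuous_family q {restr (\<phi> g) (fiber q l) | g l. True}"
    unfolding a_def equicontinuous_extension_def equicontinuous_family_restr_iff ..
  have a_b: "a \<longleftrightarrow> b"
  proof
    assume a
    have "{restr (\<phi> g) (fiber q l) | g l. True} \<subseteq> C_qq q"
      using restr_in_C_qq[OF ext] by blast
    then show b
      unfolding b_def C_qq_eq_fiber_maps[OF surj]
      by (rule equicontinuous_imp_precompact[OF closed_kernel _ \<open>a\<close>[unfolded a_iff] compact_dom]) simp
  next
    assume b
    then show a
      unfolding a_iff b_def C_qq_eq_fiber_maps[OF surj]
      by (rule precompact_imp_equicontinuous[OF order_refl])
  qed
  have c_d: "c \<longleftrightarrow> d"
    unfolding c_def d_def
  proof (intro all_cong1 imp_cong refl iffI)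
    fix f :: "'k \<Rightarrow> complex"
    let ?F = "{restr (koopman \<phi> g f) (fiber q l) | g l. True}"
    assume f: "continuous_on UNIV f"
    have "continuous_on UNIV (koopman \<phi> g f)" for g
      unfolding koopman_def by (intro continuous_on_compose \<phi> continuous_on_subset[OF f] subset_UNIV)
    then have "?F \<subseteq> fiber_maps q UNIV"
      using restr_in_C_q[of _ q] unfolding C_q_eq_fiber_maps by blast
    moreover have "compact (range f)" using f compact_dom by (rule compact_continuous_image)
    moreover have "ran \<theta> \<subseteq> range f" if "\<theta> \<in> ?F" for \<theta>
      using that by (auto simp: ran_def restr_def koopman_def restrict_map_def split: if_splits)
    ultimately show "precompactin (compact_open q (C_q q)) ?F" if "equicontinuous_family q ?F"
      unfolding C_q_eq_fiber_maps by (rule equicontinuous_imp_precompact[OF closed_UNIV _ that])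
    show "equicontinuous_family q ?F" if "precompactin (compact_open q (C_q q)) ?F"
      using that unfolding C_q_eq_fiber_maps by (rule precompact_imp_equicontinuous[OF order_refl])
  qed
  have a_c: "a \<longleftrightarrow> c"
  proof
    assume a: a
    show c
      unfolding c_def equicontinuous_family_restr_iff
    proof (intro allI impI)
      fix f :: "'k \<Rightarrow> complex" and U :: "(complex \<times> complex) set"
      assume "continuous_on UNIV f" "entourage U"
      then obtain U' where U': "entourage U'" "\<And>x y. (x, y) \<in> U' \<Longrightarrow> (f x, f y) \<in> U"
        using compact_imp_uniformly_continuous[OF compact_dom] by metis
      then show "\<exists>V. entourage V \<and> (\<forall>g x y. q x = q y \<and> (x, y) \<in> V \<longrightarrow>
          (koopman \<phi> g f x, koopman \<phi> g f y) \<in> U)"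
        using a unfolding a_def equicontinuous_extension_def koopman_def comp_def by meson
    qed
  next
    assume c: c
    show a
      unfolding a_def equicontinuous_extension_def
    proof (intro allI impI)
      fix U :: "('k \<times> 'k) set" assume "entourage U"
      then obtain T :: "('k \<Rightarrow> complex) set" where T: "finite T" "\<And>f. f \<in> T \<Longrightarrow> continuous_on UNIV f"
        "\<And>x y. (\<And>f. f \<in> T \<Longrightarrow> dist (f x) (f y) < 1/2) \<Longrightarrow> (x, y) \<in> U"
        using entourage_finitely_many_functions[OF compact_dom] by metis
      have "entourage {(z, w :: complex). dist z w < 1/2}"
        unfolding entourage_def eventually_uniformity_metric by (auto intro!: exI[of _ "1/2"])
      from c[unfolded c_def equicontinuous_family_restr_iff, rule_format, OF T(2) this]
      have "\<forall>f\<in>T. \<exists>V. entourage V \<and> (\<forall>g x y. q x = q y \<and> (x, y) \<in> V \<longrightarrow>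
          dist (f (\<phi> g x)) (f (\<phi> g y)) < 1/2)"
        by (simp add: koopman_def)
      from bchoice[OF this] obtain V where V: "\<forall>f\<in>T. entourage (V f) \<and>
          (\<forall>g x y. q x = q y \<and> (x, y) \<in> V f \<longrightarrow> dist (f (\<phi> g x)) (f (\<phi> g y)) < 1/2)" ..
      show "\<exists>V. entourage V \<and> (\<forall>g x y. q x = q y \<and> (x, y) \<in> V \<longrightarrow> (\<phi> g x, \<phi> g y) \<in> U)"
      proof (intro exI conjI allI impI)
        show "entourage {p. \<forall>f\<in>T. p \<in> V f}" using T(1) V by (intro entourage_INT) auto
        show "(\<phi> g x, \<phi> g y) \<in> U" if xy: "q x = q y \<and> (x, y) \<in> {p. \<forall>f\<in>T. p \<in> V f}" for g x y
        proof (rule T(3))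
          fix f assume "f \<in> T"
          then show "dist (f (\<phi> g x)) (f (\<phi> g y)) < 1/2" using V xy by simp
        qed
      qed
    qed
  qed
  show ?thesis using a_b a_c c_d by blast
qed

end
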